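(* For all integers $n,d\ge 2$ and all choices of $x_1,\dots,x_n\in\mathbb{R}^d$, where $x_j=(x_{j,1},\dots,x_{j,d})$, the matrix $$ \Bigl\{\prod_{i=1}^d\frac{1+\cos(x_{j,i}-x_{k,i})}{2}-\frac{1}{n}\Bigr\}_{j,k=1}^n $$ is positive semidefinite.
   Context: A matrix $M\in\mathbb{R}^{n\times n}$ is positive semidefinite if it is symmetric and $c^TMc\ge 0$ for all $c\in\mathbb{R}^n$. *)

theory Defs
  imports Complex_Main "Jordan_Normal_Form.Matrix"
begin

definition positive_semidefinite :: "real mat \<Rightarrow> bool" where
  "positive_semidefinite M \<longleftrightarrow>
     square_mat M \<and> transpose_mat M = M \<and>
     (\<forall>c \<in> carrier_vec (dim_row M). c \<bullet> (M *\<^sub>v c) \<ge> 0)"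

end

theory Submission
  imports Defs "HOL-Analysis.Convex"
begin

text \<open>
  By \<^prop>\<open>(1 + cos t) / 2 = (cos (t / 2))\<^sup>2\<close>, the product in the matrix entry is the square of
  \<open>K j k = (\<Prod>i<d. cos ((x j $ i - x k $ i) / 2))\<close>.  The kernel \<open>K\<close> is positive semidefinite with
  diagonal 1, because each cosine is a sum of two rank-one kernels by the addition theorem.

  It remains to see that the entrywise square of such a \<open>K\<close> still is positive semidefinite after
  subtracting \<open>1 / n\<close> from every entry, a sharpening of the Schur product theorem due to Vybiral.
  Write \<open>K = L L\<^sup>T\<close> with a \<^emph>\<open>square\<close> matrix \<open>L\<close>, and for a vector \<open>c\<close> let \<open>B = L\<^sup>T diag(c) L\<close>.
  Then \<open>(\<Sum>j. c j) = (\<Sum>j. c j * K j j)\<close> is the trace of \<open>B\<close>, and the quadratic form of the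
  entrywise square of \<open>K\<close> at \<open>c\<close> is the sum of the squares of all entries of \<open>B\<close>.  By the
  Cauchy-Schwarz inequality on the \<open>n\<close> diagonal entries, this sum is at least
  \<open>(\<Sum>j. c j)\<^sup>2 / n\<close>.  Squareness matters here: the constant \<open>1 / n\<close> comes from the size of \<open>B\<close>,
  while the obvious feature map of \<open>K\<close> has \<open>2 ^ d\<close> coordinates.
\<close>

section \<open>Positive semidefinite kernels on a finite set\<close>

text \<open>
  Indexing by an arbitrary set lets rows and columns be removed by passing to a subset, without
  renumbering.
\<close>

definition psd_kernel :: "'a set \<Rightarrow> ('a \<Rightarrow> 'a \<Rightarrow> real) \<Rightarrow> bool" where
  "psd_kernel S K \<longleftrightarrow>
     (\<forall>x\<in>S. \<forall>y\<in>S. K x y = K y x) \<and> (\<forall>c. 0 \<le> (\<Sum>x\<in>S. \<Sum>y\<in>S. c x * c y * K x y))"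

lemma psd_kernel_sym: "psd_kernel S K \<Longrightarrow> x \<in> S \<Longrightarrow> y \<in> S \<Longrightarrow> K x y = K y x"
  by (auto simp: psd_kernel_def)

lemma psd_kernel_nonneg: "psd_kernel S K \<Longrightarrow> 0 \<le> (\<Sum>x\<in>S. \<Sum>y\<in>S. c x * c y * K x y)"
  by (auto simp: psd_kernel_def)

lemma psd_kernel_one: "psd_kernel S (\<lambda>x y. 1)"
proof -
  have "(\<Sum>x\<in>S. \<Sum>y\<in>S. c x * c y * 1) = (\<Sum>x\<in>S. c x)\<^sup>2" for c :: "'a \<Rightarrow> real"
    by (simp add: power2_eq_square sum_product)
  then show ?thesis
    by (simp add: psd_kernel_def)
qed

lemma psd_kernel_subset:
  assumes psd: "psd_kernel S K" and "finite S" "T \<subseteq> S"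
  shows "psd_kernel T K"
  unfolding psd_kernel_def
proof (intro conjI ballI allI)
  fix x y assume "x \<in> T" "y \<in> T"
  then show "K x y = K y x"
    using psd_kernel_sym[OF psd] assms(3) by blast
next
  fix c :: "'a \<Rightarrow> real"
  define c' where "c' x = (if x \<in> T then c x else 0)" for x
  have "(\<Sum>x\<in>T. \<Sum>y\<in>T. c x * c y * K x y) = (\<Sum>x\<in>T. \<Sum>y\<in>T. c' x * c' y * K x y)"
    by (intro sum.cong refl) (simp add: c'_def)
  also have "\<dots> = (\<Sum>x\<in>T. \<Sum>y\<in>S. c' x * c' y * K x y)"
    using assms(2,3) by (intro sum.cong refl sum.mono_neutral_left) (auto simp: c'_def)
  also have "\<dots> = (\<Sum>x\<in>S. \<Sum>y\<in>S. c' x * c' y * K x y)"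
    using assms(2,3) by (intro sum.mono_neutral_left) (auto simp: c'_def)
  also have "\<dots> \<ge> 0"
    by (rule psd_kernel_nonneg[OF psd])
  finally show "0 \<le> (\<Sum>x\<in>T. \<Sum>y\<in>T. c x * c y * K x y)" .
qed

lemma psd_kernel_diag_nonneg:
  assumes "psd_kernel S K" "finite S" "a \<in> S"
  shows "0 \<le> K a a"
proof -
  have "psd_kernel {a} K"
    using assms by (intro psd_kernel_subset[OF assms(1)]) auto
  from psd_kernel_nonneg[OF this, of "\<lambda>_. 1"] show ?thesis by simp
qed

text \<open>
  The addition theorem splits the quadratic form at \<open>c\<close> into those of \<open>K\<close> at \<open>c \<cdot> cos f\<close> and at
  \<open>c \<cdot> sin f\<close>.
\<close>

lemma psd_kernel_mult_cos_diff:
  assumes "psd_kernel S K"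
  shows "psd_kernel S (\<lambda>x y. cos (f x - f y) * K x y)"
  unfolding psd_kernel_def
proof (intro conjI ballI allI)
  fix x y assume "x \<in> S" "y \<in> S"
  then show "cos (f x - f y) * K x y = cos (f y - f x) * K y x"
    using psd_kernel_sym[OF assms, of x y] by (simp add: cos_diff mult.commute)
next
  fix c :: "'a \<Rightarrow> real"
  have "(\<Sum>x\<in>S. \<Sum>y\<in>S. c x * c y * (cos (f x - f y) * K x y)) =
        (\<Sum>x\<in>S. \<Sum>y\<in>S. (c x * cos (f x)) * (c y * cos (f y)) * K x y) +
        (\<Sum>x\<in>S. \<Sum>y\<in>S. (c x * sin (f x)) * (c y * sin (f y)) * K x y)"
    unfolding sum.distrib[symmetric]
    by (intro sum.cong refl) (simp add: cos_diff algebra_simps)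
  also have "\<dots> \<ge> 0"
    by (intro add_nonneg_nonneg psd_kernel_nonneg[OF assms])
  finally show "0 \<le> (\<Sum>x\<in>S. \<Sum>y\<in>S. c x * c y * (cos (f x - f y) * K x y))" .
qed

lemma psd_kernel_prod_cos_diff:
  assumes "finite I"
  shows "psd_kernel S (\<lambda>x y. \<Prod>i\<in>I. cos (f i x - f i y))"
  using assms
proof induction
  case empty
  then show ?case by (simp add: psd_kernel_one)
next
  case (insert i I)
  then show ?case by (simp add: psd_kernel_mult_cos_diff)
qed

section \<open>Cholesky factorization\<close>

lemma discriminant_le_of_nonneg:
  fixes q b k :: real
  assumes nonneg: "\<And>s. 0 \<le> q + 2 * s * b + s\<^sup>2 * k"
  shows "b\<^sup>2 \<le> q * k"
proof (cases "k = 0")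
  case True
  have "b = 0"
  proof (rule ccontr)
    assume "b \<noteq> 0"
    then have "q + 2 * (- (q + 1) / (2 * b)) * b = -1"
      by (simp add: field_simps)
    then show False
      using nonneg[of "- (q + 1) / (2 * b)"] True by simp
  qed
  then show ?thesis using True by simp
next
  case False
  have "k \<ge> 0"
  proof (rule ccontr)
    assume "\<not> k \<ge> 0"
    then have "k < 0" by simp
    \<comment> \<open>Averaging over \<open>s\<close> and \<open>- s\<close> cancels the linear term.\<close>
    have even: "0 \<le> q + s\<^sup>2 * k" for s
      using nonneg[of s] nonneg[of "- s"] by simp
    have "(sqrt ((\<bar>q\<bar> + 1) / (- k)))\<^sup>2 * k = - (\<bar>q\<bar> + 1)"
      using \<open>k < 0\<close> by (simp add: divide_nonneg_neg divide_nonpos_neg field_simps)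
    then show False
      using even[of "sqrt ((\<bar>q\<bar> + 1) / (- k))"] by simp
  qed
  with False have "k > 0" by simp
  have "q + 2 * (- b / k) * b + (- b / k)\<^sup>2 * k = q - b\<^sup>2 / k"
    using \<open>k > 0\<close> by (simp add: field_simps power2_eq_square)
  then have "b\<^sup>2 / k \<le> q"
    using nonneg[of "- b / k"] by simp
  then show ?thesis
    using \<open>k > 0\<close> by (simp add: field_simps)
qed

text \<open>
  Cauchy-Schwarz for the form of \<open>K\<close>, between \<open>c\<close> and the unit vector at \<open>a\<close>.  It makes the Schur
  complement of the entry \<open>K a a\<close> positive semidefinite, and it forces the column of \<open>a\<close> to vanish
  when \<open>K a a = 0\<close>.
\<close>

lemma psd_kernel_insert_Cauchy_Schwarz:
  assumes "finite S" "a \<notin> S" and psd: "psd_kernel (insert a S) K"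
  shows "(\<Sum>x\<in>S. c x * K x a)\<^sup>2 \<le> (\<Sum>x\<in>S. \<Sum>y\<in>S. c x * c y * K x y) * K a a"
proof (rule discriminant_le_of_nonneg)
  fix s :: real
  define c' where "c' = c(a := s)"
  have c': "c' a = s" "\<And>x. x \<in> S \<Longrightarrow> c' x = c x"
    using assms(2) by (auto simp: c'_def)
  have sym: "\<And>y. y \<in> S \<Longrightarrow> K a y = K y a"
    using psd_kernel_sym[OF psd] by blast
  have "0 \<le> (\<Sum>x\<in>insert a S. \<Sum>y\<in>insert a S. c' x * c' y * K x y)"
    by (rule psd_kernel_nonneg[OF psd])
  also have "\<dots> = s * s * K a a + (\<Sum>y\<in>S. s * c y * K y a)
      + ((\<Sum>x\<in>S. c x * s * K x a) + (\<Sum>x\<in>S. \<Sum>y\<in>S. c x * c y * K x y))"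
    using assms(1,2) by (simp add: c' sym sum.distrib)
  also have "(\<Sum>y\<in>S. s * c y * K y a) = s * (\<Sum>x\<in>S. c x * K x a)"
    by (simp add: sum_distrib_left mult.assoc)
  also have "(\<Sum>x\<in>S. c x * s * K x a) = s * (\<Sum>x\<in>S. c x * K x a)"
    by (simp add: sum_distrib_left mult_ac)
  finally show "0 \<le> (\<Sum>x\<in>S. \<Sum>y\<in>S. c x * c y * K x y)
      + 2 * s * (\<Sum>x\<in>S. c x * K x a) + s\<^sup>2 * K a a"
    by (simp add: power2_eq_square algebra_simps)
qed

lemma psd_kernel_Schur_complement:
  assumes "finite S" "a \<notin> S" and psd: "psd_kernel (insert a S) K"
  shows "psd_kernel S (\<lambda>x y. K x y - K x a * K y a / K a a)"
  unfolding psd_kernel_def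
proof (intro conjI ballI allI)
  fix x y assume "x \<in> S" "y \<in> S"
  then show "K x y - K x a * K y a / K a a = K y x - K y a * K x a / K a a"
    using psd_kernel_sym[OF psd, of x y] by simp
next
  fix c :: "'a \<Rightarrow> real"
  define Q b where "Q = (\<Sum>x\<in>S. \<Sum>y\<in>S. c x * c y * K x y)" and "b = (\<Sum>x\<in>S. c x * K x a)"
  have le: "b\<^sup>2 \<le> Q * K a a"
    unfolding Q_def b_def by (rule psd_kernel_insert_Cauchy_Schwarz[OF assms])
  have Q: "Q \<ge> 0"
    unfolding Q_def using assms(1)
    by (intro psd_kernel_nonneg psd_kernel_subset[OF psd]) auto
  have diag: "K a a \<ge> 0"
    using assms(1) by (intro psd_kernel_diag_nonneg[OF psd]) auto
  have "(\<Sum>x\<in>S. \<Sum>y\<in>S. c x * c y * (K x y - K x a * K y a / K a a)) = Q - b\<^sup>2 / K a a"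
    by (simp add: Q_def b_def power2_eq_square sum_product sum_subtractf sum_divide_distrib
        right_diff_distrib mult_ac)
  also have "\<dots> \<ge> 0"
    using le Q diag by (cases "K a a = 0") (auto simp: field_simps)
  finally show "0 \<le> (\<Sum>x\<in>S. \<Sum>y\<in>S. c x * c y * (K x y - K x a * K y a / K a a))" .
qed

text \<open>
  Induction over \<open>S\<close>, splitting off one row and column by the Schur complement; the new column of
  \<open>L\<close> is \<open>K x a / sqrt (K a a)\<close>.  Indexing the columns by \<open>S\<close> itself records that \<open>L\<close> is square.
\<close>

lemma psd_kernel_Cholesky:
  assumes "finite S" "psd_kernel S K"
  shows "\<exists>L. \<forall>x\<in>S. \<forall>y\<in>S. K x y = (\<Sum>z\<in>S. L x z * L y z)"
  using assms
proof (induction arbitrary: K)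
  case empty
  then show ?case by simp
next
  case (insert a S)
  note psd = insert.prems
  from insert.IH[OF psd_kernel_Schur_complement[OF insert.hyps psd]] obtain L where
    L: "\<And>x y. x \<in> S \<Longrightarrow> y \<in> S \<Longrightarrow> K x y - K x a * K y a / K a a = (\<Sum>z\<in>S. L x z * L y z)"
    by blast
  have sym: "\<And>y. y \<in> S \<Longrightarrow> K a y = K y a"
    using psd_kernel_sym[OF psd] by blast
  have diag: "K a a \<ge> 0"
    using insert.hyps(1) by (intro psd_kernel_diag_nonneg[OF psd]) auto
  have col: "K x a = 0" if "x \<in> S" "K a a = 0" for x
  proof -
    have "a \<notin> {x}"
      using that insert.hyps by auto
    moreover have "psd_kernel (insert a {x}) K"
      using that insert.hyps by (intro psd_kernel_subset[OF psd]) auto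
    ultimately have "(\<Sum>y\<in>{x}. 1 * K y a)\<^sup>2 \<le> (\<Sum>y\<in>{x}. \<Sum>z\<in>{x}. 1 * 1 * K y z) * K a a"
      by (intro psd_kernel_insert_Cauchy_Schwarz) auto
    then show ?thesis
      using that by simp
  qed
  \<comment> \<open>If \<open>K a a = 0\<close>, division by zero makes the column of \<open>a\<close> vanish, as it must.\<close>
  define L' where
    "L' x z = (if z = a then K x a / sqrt (K a a) else if x = a then 0 else L x z)" for x z
  have expand: "(\<Sum>z\<in>insert a S. L' x z * L' y z) =
      K x a * K y a / K a a + (\<Sum>z\<in>S. L' x z * L' y z)" for x y
    using insert.hyps diag by (simp add: L'_def)
  have row: "(\<Sum>z\<in>S. L' x z * L' y z) = 0" if "x = a \<or> y = a" for x y
    using that insert.hyps(2) by (intro sum.neutral) (auto simp: L'_def)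
  have rest: "(\<Sum>z\<in>S. L' x z * L' y z) = (\<Sum>z\<in>S. L x z * L y z)" if "x \<in> S" "y \<in> S" for x y
    using that insert.hyps(2) by (intro sum.cong) (auto simp: L'_def)
  have "K x y = (\<Sum>z\<in>insert a S. L' x z * L' y z)"
    if xy: "x \<in> insert a S" "y \<in> insert a S" for x y
  proof (cases "x \<in> S \<and> y \<in> S")
    case True
    then have "(\<Sum>z\<in>insert a S. L' x z * L' y z) =
        K x a * K y a / K a a + (K x y - K x a * K y a / K a a)"
      unfolding expand by (simp only: rest L)
    then show ?thesis by simp
  next
    case False
    with xy have a: "x = a \<or> y = a" by blast
    then have "(\<Sum>z\<in>insert a S. L' x z * L' y z) = K x a * K y a / K a a"
      unfolding expand by (simp only: row add_0_right)
    also have "\<dots> = K x y"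
    proof (cases "K a a = 0")
      case True
      with a xy show ?thesis using col sym by (metis div_by_0 insertE)
    next
      case False
      with a xy show ?thesis using sym by (metis insertE mult.commute nonzero_mult_div_cancel_right)
    qed
    finally show ?thesis by simp
  qed
  then show ?case by blast
qed

section \<open>Vybiral's lower bound for the entrywise square\<close>

text \<open>
  With \<open>K = L L\<^sup>T\<close> and \<open>B = L\<^sup>T diag(c) L\<close>, the sum of the entries of \<open>c\<close> is the trace of \<open>B\<close>, since
  \<open>K\<close> has diagonal 1, and the double sum is the squared Frobenius norm of \<open>B\<close>.
\<close>

lemma sum_squared_le_card_mult_sum_squares_kernel:
  assumes fin: "finite S" and psd: "psd_kernel S K" and diag: "\<And>x. x \<in> S \<Longrightarrow> K x x = 1"
  shows "(\<Sum>x\<in>S. c x)\<^sup>2 \<le> real (card S) * (\<Sum>x\<in>S. \<Sum>y\<in>S. c x * c y * (K x y)\<^sup>2)"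
proof -
  from psd_kernel_Cholesky[OF fin psd] obtain L where
    L: "\<And>x y. x \<in> S \<Longrightarrow> y \<in> S \<Longrightarrow> K x y = (\<Sum>z\<in>S. L x z * L y z)"
    by blast
  define B where "B z w = (\<Sum>x\<in>S. c x * (L x z * L x w))" for z w
  have trace: "(\<Sum>x\<in>S. c x) = (\<Sum>z\<in>S. B z z)"
  proof -
    have "(\<Sum>x\<in>S. c x) = (\<Sum>x\<in>S. c x * K x x)"
      using diag by simp
    also have "\<dots> = (\<Sum>x\<in>S. \<Sum>z\<in>S. c x * (L x z * L x z))"
      by (simp add: L sum_distrib_left)
    also have "\<dots> = (\<Sum>z\<in>S. B z z)"
      unfolding B_def by (rule sum.swap)
    finally show ?thesis .
  qed
  have frobenius: "(\<Sum>x\<in>S. \<Sum>y\<in>S. c x * c y * (K x y)\<^sup>2) = (\<Sum>z\<in>S. \<Sum>w\<in>S. (B z w)\<^sup>2)"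
  proof -
    have K_sq: "(K x y)\<^sup>2 = (\<Sum>z\<in>S. \<Sum>w\<in>S. (L x z * L y z) * (L x w * L y w))"
      if "x \<in> S" "y \<in> S" for x y
      by (simp add: L[OF that] power2_eq_square sum_product)
    have "(\<Sum>z\<in>S. \<Sum>w\<in>S. (B z w)\<^sup>2) =
        (\<Sum>z\<in>S. \<Sum>w\<in>S. \<Sum>x\<in>S. \<Sum>y\<in>S. c x * c y * ((L x z * L y z) * (L x w * L y w)))"
      by (simp add: B_def power2_eq_square sum_product mult_ac)
    also have "\<dots> = (\<Sum>z\<in>S. \<Sum>x\<in>S. \<Sum>w\<in>S. \<Sum>y\<in>S. c x * c y * ((L x z * L y z) * (L x w * L y w)))"
      by (intro sum.cong refl sum.swap)
    also have "\<dots> = (\<Sum>x\<in>S. \<Sum>z\<in>S. \<Sum>w\<in>S. \<Sum>y\<in>S. c x * c y * ((L x z * L y z) * (L x w * L y w)))"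
      by (rule sum.swap)
    also have "\<dots> = (\<Sum>x\<in>S. \<Sum>z\<in>S. \<Sum>y\<in>S. \<Sum>w\<in>S. c x * c y * ((L x z * L y z) * (L x w * L y w)))"
      by (intro sum.cong refl sum.swap)
    also have "\<dots> = (\<Sum>x\<in>S. \<Sum>y\<in>S. \<Sum>z\<in>S. \<Sum>w\<in>S. c x * c y * ((L x z * L y z) * (L x w * L y w)))"
      by (intro sum.cong refl sum.swap)
    also have "\<dots> = (\<Sum>x\<in>S. \<Sum>y\<in>S. c x * c y * (K x y)\<^sup>2)"
      by (intro sum.cong refl) (simp add: K_sq sum_distrib_left)
    finally show ?thesis by simp
  qed
  have "(\<Sum>z\<in>S. B z z)\<^sup>2 \<le> real (card S) * (\<Sum>z\<in>S. (B z z)\<^sup>2)"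
    using sum_squared_le_sum_of_squares[of "\<lambda>z. B z z" S] fin
    by (simp add: mult.commute)
  also have "\<dots> \<le> real (card S) * (\<Sum>z\<in>S. \<Sum>w\<in>S. (B z w)\<^sup>2)"
    using fin by (intro mult_left_mono sum_mono member_le_sum) auto
  finally show ?thesis
    by (simp add: trace frobenius)
qed

section \<open>The cosine matrix\<close>

lemma half_one_plus_cos: "(1 + cos t) / 2 = (cos (t / 2))\<^sup>2" for t :: real
  using cos_double_cos[of "t / 2"] by simp

theorem mainTheorem3:
  fixes n d :: nat and x :: "nat \<Rightarrow> real vec"
  assumes "n \<ge> 2" and "d \<ge> 2"
    and "\<And>j. j < n \<Longrightarrow> x j \<in> carrier_vec d"
  shows "positive_semidefinite
    (mat n n (\<lambda>(j, k). (\<Prod>i<d. (1 + cos (x j $ i - x k $ i)) / 2) - 1 / real n))"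
proof -
  define K where "K j k = (\<Prod>i<d. cos (x j $ i / 2 - x k $ i / 2))" for j k
  have psd: "psd_kernel {..<n} K"
    unfolding K_def by (rule psd_kernel_prod_cos_diff) simp
  have diag: "K j j = 1" for j
    by (simp add: K_def)
  have entry: "(\<Prod>i<d. (1 + cos (x j $ i - x k $ i)) / 2) = (K j k)\<^sup>2" for j k
    by (simp add: K_def half_one_plus_cos diff_divide_distrib prod_power_distrib)
  define M where "M = mat n n (\<lambda>(j, k). (K j k)\<^sup>2 - 1 / real n)"
  have "transpose_mat M = M"
    by (rule eq_matI) (auto simp: M_def psd_kernel_sym[OF psd])
  moreover have "c \<bullet> (M *\<^sub>v c) \<ge> 0" if c: "c \<in> carrier_vec n" for c
  proof -
    have "c \<bullet> (M *\<^sub>v c) = (\<Sum>j<n. \<Sum>k<n. c $ j * c $ k * ((K j k)\<^sup>2 - 1 / real n))"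
      using c by (simp add: M_def scalar_prod_def lessThan_atLeast0 sum_distrib_left mult_ac)
    also have "\<dots> = (\<Sum>j<n. \<Sum>k<n. c $ j * c $ k * (K j k)\<^sup>2) - (\<Sum>j<n. c $ j)\<^sup>2 / real n"
      by (simp add: right_diff_distrib sum_subtractf power2_eq_square sum_product sum_divide_distrib)
    also have "\<dots> \<ge> 0"
      using sum_squared_le_card_mult_sum_squares_kernel[OF _ psd diag, of "\<lambda>j. c $ j"] assms(1)
      by (simp add: field_simps)
    finally show ?thesis .
  qed
  ultimately have "positive_semidefinite M"
    by (simp add: positive_semidefinite_def M_def)
  then show ?thesis
    by (simp add: M_def entry)
qed

end
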